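(* Let $\mathcal{G}$ be a geometric algebra. For all multivectors $A,B,C\in\mathcal{G}$: $$A\wedge(B\wedge C)=(A\wedge B)\wedge C,$$ $$A\rfloor(B\lfloor C)=(A\rfloor B)\lfloor C,$$ $$A\rfloor(B\rfloor C)=(A\wedge B)\rfloor C,$$ $$A\lfloor(B\wedge C)=(A\lfloor B)\lfloor C.$$
   Context: A geometric algebra $\mathcal{G}$ is a ring with unit containing a field $\mathcal{G}_0$ of characteristic zero (the scalars, with $0,1\in\mathcal{G}_0$) and a subset $\mathcal{G}_1$ (the vectors) closed under addition with $\lambda v=v\lambda\in\mathcal{G}_1$ for all $\lambda\in\mathcal{G}_0$, $v\in\mathcal{G}_1$ (so $\mathcal{G}_1$ is a $\mathcal{G}_0$-vector space), such that: the square of every vector is a scalar; the symmetric bilinear inner product of vectors $\frac12(uv+vu)\in\mathcal{G}_0$ is nondegenerate (the only vector orthogonal to all vectors is $0$); and $\mathcal{G}$ is the direct sum of the subspaces $\mathcal{G}_r$, $r\ge 0$, defined as follows. Vectors $u,v$ are orthogonal if $\frac12(uv+vu)=0$. For $r\ge 2$ an $r$-blade is a product of $r$ pairwise orthogonal vectors; $0$-blades are the scalars and $1$-blades the vectors. An $r$-vector is a finite sum of $r$-blades, and $\mathcal{G}_r$ is the set of $r$-vectors. Elements of $\mathcal{G}$ are called multivectors. $\langle A\rangle_r$ denotes the component of $A\in\mathcal{G}$ in $\mathcal{G}_r$, with $\langle A\rangle_r=0$ for $r<0$. For $A=\sum_rA_r$ and $B=\sum_sB_s$ with $A_r\in\mathcal{G}_r$,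 $B_s\in\mathcal{G}_s$, the left inner, right inner and outer products are $$A\rfloor B:=\sum_{r,s}\langle A_rB_s\rangle_{s-r},\quad A\lfloor B:=\sum_{r,s}\langle A_rB_s\rangle_{r-s},\quad A\wedge B:=\sum_{r,s}\langle A_rB_s\rangle_{r+s}.$$ *)

theory Defs
  imports Main
begin

text \<open>
  The ring is the whole type \<open>'a\<close>; the scalars \<open>G0\<close> and the vectors \<open>G1\<close> are subsets of it.
  Since \<open>1 \<in> G0\<close>, the field \<open>G0\<close> has characteristic zero iff the ring does, so this hypothesis
  is the class \<open>ring_char_0\<close>.
\<close>

text \<open>\<open>ring_char_0\<close> has no division, so 1/2 is the inverse of 2 in the field \<open>G0\<close>.\<close>

definition half :: "'a::ring_char_0 set \<Rightarrow> 'a" where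
  "half G0 = (THE h. h \<in> G0 \<and> 2 * h = 1)"

definition vinner :: "'a::ring_char_0 set \<Rightarrow> 'a \<Rightarrow> 'a \<Rightarrow> 'a" where
  "vinner G0 u v = half G0 * (u * v + v * u)"

definition blades :: "'a::ring_char_0 set \<Rightarrow> 'a set \<Rightarrow> nat \<Rightarrow> 'a set" where
  "blades G0 G1 r =
    (if r = 0 then G0
     else {prod_list vs | vs. length vs = r \<and> set vs \<subseteq> G1 \<and>
             (\<forall>i<r. \<forall>j<r. i \<noteq> j \<longrightarrow> vinner G0 (vs ! i) (vs ! j) = 0)})"

definition grade :: "'a::ring_char_0 set \<Rightarrow> 'a set \<Rightarrow> nat \<Rightarrow> 'a set" where
  "grade G0 G1 r = {sum_list bs | bs. set bs \<subseteq> blades G0 G1 r}"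

definition is_decomp :: "'a::ring_char_0 set \<Rightarrow> 'a set \<Rightarrow> 'a \<Rightarrow> (nat \<Rightarrow> 'a) \<Rightarrow> bool" where
  "is_decomp G0 G1 A f \<longleftrightarrow>
    (\<forall>r. f r \<in> grade G0 G1 r) \<and> finite {r. f r \<noteq> 0} \<and> A = (\<Sum>r | f r \<noteq> 0. f r)"

locale geometric_algebra =
  fixes G0 G1 :: "'a::ring_char_0 set"
  assumes zero_scalar: "0 \<in> G0"
    and one_scalar: "1 \<in> G0"
    and add_scalar: "\<And>a b. a \<in> G0 \<Longrightarrow> b \<in> G0 \<Longrightarrow> a + b \<in> G0"
    and uminus_scalar: "\<And>a. a \<in> G0 \<Longrightarrow> - a \<in> G0"
    and mult_scalar: "\<And>a b. a \<in> G0 \<Longrightarrow> b \<in> G0 \<Longrightarrow> a * b \<in> G0"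
    and commute_scalar: "\<And>a b. a \<in> G0 \<Longrightarrow> b \<in> G0 \<Longrightarrow> a * b = b * a"
    and inverse_scalar: "\<And>a. a \<in> G0 \<Longrightarrow> a \<noteq> 0 \<Longrightarrow> \<exists>b\<in>G0. a * b = 1"
    and vectors_nonempty: "G1 \<noteq> {}"
    and add_vector: "\<And>u v. u \<in> G1 \<Longrightarrow> v \<in> G1 \<Longrightarrow> u + v \<in> G1"
    and scale_vector: "\<And>a v. a \<in> G0 \<Longrightarrow> v \<in> G1 \<Longrightarrow> a * v \<in> G1"
    and scalar_vector_commute: "\<And>a v. a \<in> G0 \<Longrightarrow> v \<in> G1 \<Longrightarrow> a * v = v * a"
    and square_scalar: "\<And>v. v \<in> G1 \<Longrightarrow> v\<^sup>2 \<in> G0"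
    and nondegenerate: "\<And>u. u \<in> G1 \<Longrightarrow> (\<And>v. v \<in> G1 \<Longrightarrow> vinner G0 u v = 0) \<Longrightarrow> u = 0"
    and direct_sum: "\<And>A. \<exists>!f. is_decomp G0 G1 A f"

definition components :: "'a::ring_char_0 set \<Rightarrow> 'a set \<Rightarrow> 'a \<Rightarrow> nat \<Rightarrow> 'a" where
  "components G0 G1 A = (THE f. is_decomp G0 G1 A f)"

definition gpart :: "'a::ring_char_0 set \<Rightarrow> 'a set \<Rightarrow> 'a \<Rightarrow> int \<Rightarrow> 'a" where
  "gpart G0 G1 A k = (if k < 0 then 0 else components G0 G1 A (nat k))"

text \<open>The three products have the common shape of summing \<open>\<langle>A\<^sub>r B\<^sub>s\<rangle>\<close> in the grade \<open>d r s\<close>.\<close>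

definition graded_prod ::
  "(int \<Rightarrow> int \<Rightarrow> int) \<Rightarrow> 'a::ring_char_0 set \<Rightarrow> 'a set \<Rightarrow> 'a \<Rightarrow> 'a \<Rightarrow> 'a" where
  "graded_prod d G0 G1 A B =
    (\<Sum>r | components G0 G1 A r \<noteq> 0. \<Sum>s | components G0 G1 B s \<noteq> 0.
       gpart G0 G1 (components G0 G1 A r * components G0 G1 B s) (d (int r) (int s)))"

definition left_inner :: "'a::ring_char_0 set \<Rightarrow> 'a set \<Rightarrow> 'a \<Rightarrow> 'a \<Rightarrow> 'a" where
  "left_inner G0 G1 = graded_prod (\<lambda>r s. s - r) G0 G1"

definition right_inner :: "'a::ring_char_0 set \<Rightarrow> 'a set \<Rightarrow> 'a \<Rightarrow> 'a \<Rightarrow> 'a" where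
  "right_inner G0 G1 = graded_prod (\<lambda>r s. r - s) G0 G1"

definition outer :: "'a::ring_char_0 set \<Rightarrow> 'a set \<Rightarrow> 'a \<Rightarrow> 'a \<Rightarrow> 'a" where
  "outer G0 G1 = graded_prod (\<lambda>r s. r + s) G0 G1"

end

theory Submission
  imports Defs
begin

text \<open>
  The heart of the matter is that the product of an \<open>r\<close>-vector and an \<open>s\<close>-vector only has components
  of grades \<open>|r - s|, \<dots>, r + s\<close>. The vectors occurring in two given blades lie in the span of a
  finite set \<open>E\<close> of pairwise orthogonal vectors, since any symmetric bilinear form, degenerate or not,
  can be diagonalised on a finitely generated space. Each blade is then a combination of products of
  distinct elements of \<open>E\<close>, and by uniqueness of the decomposition into grades only products of the
  right length occur. The product of two such words with letters \<open>X\<close> and \<open>Y\<close> is a scalar multiple of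
  a word with letters in the symmetric difference of \<open>X\<close> and \<open>Y\<close>, which bounds its length.
  Given the range of grades, in each of the four identities both sides pick the same component of
  \<open>A\<^sub>r B\<^sub>s C\<^sub>t\<close>.
\<close>

section \<open>Linear spans over the scalars\<close>

inductive_set lin :: "'a::ring_1 set \<Rightarrow> 'a set \<Rightarrow> 'a set" for F S where
  lin_zero: "0 \<in> lin F S"
| lin_base: "x \<in> S \<Longrightarrow> x \<in> lin F S"
| lin_add: "x \<in> lin F S \<Longrightarrow> y \<in> lin F S \<Longrightarrow> x + y \<in> lin F S"
| lin_scale: "a \<in> F \<Longrightarrow> x \<in> lin F S \<Longrightarrow> a * x \<in> lin F S"

lemma lin_trans: "x \<in> lin F S \<Longrightarrow> S \<subseteq> lin F T \<Longrightarrow> x \<in> lin F T"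
  by (induction rule: lin.induct) (auto intro: lin.intros)

lemma lin_mono: "S \<subseteq> T \<Longrightarrow> lin F S \<subseteq> lin F T"
  by (auto intro: lin_trans lin_base)

context geometric_algebra
begin

abbreviation comp :: "'a \<Rightarrow> nat \<Rightarrow> 'a" where "comp \<equiv> components G0 G1"
abbreviation part :: "'a \<Rightarrow> int \<Rightarrow> 'a" where "part \<equiv> gpart G0 G1"
abbreviation gr :: "nat \<Rightarrow> 'a set" where "gr \<equiv> grade G0 G1"

section \<open>Scalars, vectors and orthogonality\<close>

text \<open>\<open>half\<close> is a definite description, so its properties become available only
  after the inverse of 2 in the field is shown to be unique.\<close>

lemma half: "half G0 \<in> G0" "2 * half G0 = 1"
proof -
  have "(2::'a) \<in> G0"
    using add_scalar[OF one_scalar one_scalar] by simp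
  then obtain h where h: "h \<in> G0" "2 * h = 1"
    using inverse_scalar[of 2] by auto
  have "h' = h" if "h' \<in> G0" "2 * h' = 1" for h'
  proof -
    have "h * 2 = 1"
      using h commute_scalar[OF \<open>2 \<in> G0\<close> h(1)] by simp
    then have "h' = h * (2 * h')"
      by (simp add: mult.assoc[symmetric])
    then show ?thesis using that by simp
  qed
  then have "half G0 \<in> G0 \<and> 2 * half G0 = 1"
    unfolding half_def using h by (intro theI[of "\<lambda>h. h \<in> G0 \<and> 2 * h = 1" h]) blast+
  then show "half G0 \<in> G0" "2 * half G0 = 1" by auto
qed

text \<open>The factor one half is invertible. Orthogonality thereby becomes anticommutation, the
  form used from here on.\<close>

lemma vinner_eq_0_iff: "vinner G0 u v = 0 \<longleftrightarrow> u * v + v * u = 0"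
proof
  assume "vinner G0 u v = 0"
  then have "2 * half G0 * (u * v + v * u) = 0"
    by (simp add: vinner_def mult.assoc)
  then show "u * v + v * u = 0" by (simp add: half)
qed (simp add: vinner_def)

text \<open>Polarisation: the axioms place only squares of vectors among the scalars.\<close>

lemma anticommutator_scalar:
  assumes "u \<in> G1" "v \<in> G1" shows "u * v + v * u \<in> G0"
proof -
  have "u * v + v * u = (u + v)\<^sup>2 + (- (u\<^sup>2) + - (v\<^sup>2))"
    by (simp add: power2_eq_square algebra_simps)
  then show ?thesis
    using assms by (simp only:) (intro add_scalar uminus_scalar square_scalar add_vector)
qed

lemma zero_vector: "0 \<in> G1"
  using vectors_nonempty scale_vector[OF zero_scalar] by force

lemma lin_vector: "x \<in> lin G0 S \<Longrightarrow> S \<subseteq> G1 \<Longrightarrow> x \<in> G1"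
  by (induction rule: lin.induct) (auto intro: zero_vector add_vector scale_vector)

lemma minus_one_scalar: "- 1 \<in> G0"
  using uminus_scalar one_scalar by blast

lemma lin_uminus: "x \<in> lin G0 S \<Longrightarrow> - x \<in> lin G0 S"
  using lin_scale[OF minus_one_scalar] by force

lemma lin_diff: "x \<in> lin G0 S \<Longrightarrow> y \<in> lin G0 S \<Longrightarrow> x - y \<in> lin G0 S"
  using lin_add lin_uminus by force

section \<open>Blades and scalar multiples\<close>

text \<open>The axioms let scalars commute with scalars and vectors. This is carried to products of
  vectors, then to blades, and in \<open>scalar_commute\<close> to the whole ring.\<close>

lemma scalar_prod_list_commute:
  "a \<in> G0 \<Longrightarrow> set vs \<subseteq> G1 \<Longrightarrow> a * prod_list vs = prod_list vs * a"
proof (induction vs)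
  case (Cons v vs)
  then have "a * v = v * a" by (intro scalar_vector_commute) auto
  then have "a * (v * prod_list vs) = v * (a * prod_list vs)"
    by (simp add: mult.assoc[symmetric])
  with Cons show ?case by (simp add: mult.assoc)
qed simp

lemma scalar_blade_commute:
  "a \<in> G0 \<Longrightarrow> b \<in> blades G0 G1 r \<Longrightarrow> a * b = b * a"
  by (auto simp: blades_def commute_scalar scalar_prod_list_commute split: if_splits)

text \<open>The scalar is absorbed into the first factor, whose orthogonality to the others survives
  because scalars commute with vectors. This makes \<open>gr r\<close> a subspace although it
  consists of plain sums of blades.\<close>

lemma scale_blade:
  assumes a: "a \<in> G0" and b: "b \<in> blades G0 G1 r"
  shows "a * b \<in> blades G0 G1 r"
proof (cases "r = 0")
  case True
  with assms show ?thesis by (simp add: blades_def mult_scalar)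
next
  case False
  with b obtain vs where vs: "b = prod_list vs" "length vs = r" "set vs \<subseteq> G1"
    "\<And>i j. i < r \<Longrightarrow> j < r \<Longrightarrow> i \<noteq> j \<Longrightarrow> vs ! i * vs ! j + vs ! j * vs ! i = 0"
    by (auto simp: blades_def vinner_eq_0_iff)
  with False obtain v ws where ws: "vs = v # ws" by (cases vs) auto
  have comm: "a * v = v * a" using vs ws a by (intro scalar_vector_commute) auto
  have wc: "w * a = a * w" if "w \<in> set ws" for w
    using that vs(3) ws a by (intro scalar_vector_commute[symmetric]) auto
  have ortho: "v * w + w * v = 0 \<Longrightarrow> w \<in> set ws \<Longrightarrow> a * v * w + w * (a * v) = 0" for w
  proof -
    assume w: "v * w + w * v = 0" "w \<in> set ws"
    have "a * v * w + w * (a * v) = a * (v * w + w * v)"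
      using wc[OF w(2)] by (simp add: distrib_left mult.assoc[symmetric])
    with w show "a * v * w + w * (a * v) = 0" by simp
  qed
  have "((a * v) # ws) ! i * ((a * v) # ws) ! j + ((a * v) # ws) ! j * ((a * v) # ws) ! i = 0"
    if ij: "i < r" "j < r" "i \<noteq> j" for i j
  proof (cases i)
    case 0
    then obtain k where k: "j = Suc k" using ij by (cases j) auto
    with 0 vs(4)[OF ij] vs(2) ws ij show ?thesis by (simp add: ortho)
  next
    case (Suc k)
    show ?thesis
    proof (cases j)
      case 0
      with Suc vs(4)[OF ij(2,1)] vs(2) ws ij ortho[of "ws ! k"] show ?thesis
        by (simp add: add.commute)
    next
      case (Suc l)
      with \<open>i = Suc k\<close> vs(4)[OF ij] ws show ?thesis by simp
    qed
  qed
  moreover have "a * b = prod_list ((a * v) # ws)" "length ((a * v) # ws) = r" "set ((a * v) # ws) \<subseteq> G1"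
    using vs ws a by (auto simp: mult.assoc intro: scale_vector)
  ultimately show ?thesis
    using False unfolding blades_def vinner_eq_0_iff by (simp only: if_False) blast
qed

section \<open>Grade subspaces and components\<close>

lemma zero_grade: "0 \<in> gr r"
  unfolding grade_def by (auto intro!: exI[of _ "[]"])

lemma add_grade: assumes "x \<in> gr r" "y \<in> gr r" shows "x + y \<in> gr r"
proof -
  obtain bs cs where "x = sum_list bs" "set bs \<subseteq> blades G0 G1 r"
    "y = sum_list cs" "set cs \<subseteq> blades G0 G1 r"
    using assms unfolding grade_def by auto
  then show ?thesis unfolding grade_def by (auto intro!: exI[of _ "bs @ cs"])
qed

lemma blade_grade: "b \<in> blades G0 G1 r \<Longrightarrow> b \<in> gr r"
  unfolding grade_def by (auto intro!: exI[of _ "[b]"])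

lemma scale_grade: assumes "a \<in> G0" "x \<in> gr r" shows "a * x \<in> gr r"
proof -
  obtain bs where "x = sum_list bs" "set bs \<subseteq> blades G0 G1 r"
    using assms unfolding grade_def by auto
  then show ?thesis using assms(1) unfolding grade_def
    by (auto intro!: exI[of _ "map ((*) a) bs"] simp: sum_list_const_mult scale_blade subset_iff)
qed

lemma grade_lin_blades: "gr r \<subseteq> lin G0 (blades G0 G1 r)"
proof -
  have "sum_list bs \<in> lin G0 (blades G0 G1 r)" if "set bs \<subseteq> blades G0 G1 r" for bs
    using that by (induction bs) (auto intro: lin.intros)
  then show ?thesis unfolding grade_def by auto
qed

lemma comp_decomp: "is_decomp G0 G1 A (comp A)"
  unfolding components_def by (rule theI'[OF direct_sum])

lemma comp_unique: "is_decomp G0 G1 A f \<Longrightarrow> comp A = f"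
  using direct_sum comp_decomp by blast

lemma comp_grade: "comp A r \<in> gr r"
  and comp_finite: "finite {r. comp A r \<noteq> 0}"
  and comp_sum: "A = (\<Sum>r | comp A r \<noteq> 0. comp A r)"
  using comp_decomp[of A] unfolding is_decomp_def by blast+

lemma comp_add: "comp (A + B) r = comp A r + comp B r"
proof -
  let ?f = "\<lambda>r. comp A r + comp B r"
  let ?S = "{r. comp A r \<noteq> 0} \<union> {r. comp B r \<noteq> 0}"
  have fin: "finite ?S" by (simp add: comp_finite)
  \<comment> \<open>Cancellation may shrink the support of the sum, so all sums are taken over the
    union of the two supports.\<close>
  have "(\<Sum>r | ?f r \<noteq> 0. ?f r) = (\<Sum>r\<in>?S. ?f r)"
    using fin by (intro sum.mono_neutral_left) auto
  also have "\<dots> = (\<Sum>r\<in>?S. comp A r) + (\<Sum>r\<in>?S. comp B r)"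
    by (rule sum.distrib)
  also have "(\<Sum>r\<in>?S. comp A r) = A"
    using fin by (intro trans[OF _ comp_sum[of A, symmetric]] sum.mono_neutral_right) auto
  also have "(\<Sum>r\<in>?S. comp B r) = B"
    using fin by (intro trans[OF _ comp_sum[of B, symmetric]] sum.mono_neutral_right) auto
  finally have "(\<Sum>r | ?f r \<noteq> 0. ?f r) = A + B" .
  moreover have "finite {r. ?f r \<noteq> 0}"
    by (rule finite_subset[OF _ fin]) auto
  ultimately have "is_decomp G0 G1 (A + B) ?f"
    unfolding is_decomp_def by (auto intro: add_grade comp_grade)
  from comp_unique[OF this] show ?thesis by simp
qed

lemma comp_homogeneous: assumes "x \<in> gr r" shows "comp x = (\<lambda>k. if k = r then x else 0)"
proof (rule comp_unique)
  \<comment> \<open>For \<open>x = 0\<close> the support is empty instead of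
    \<open>{r}\<close>.\<close>
  have "{k. (if k = r then x else 0) \<noteq> 0} = (if x = 0 then {} else {r})" by auto
  then show "is_decomp G0 G1 x (\<lambda>k. if k = r then x else 0)"
    unfolding is_decomp_def using assms by (auto simp: zero_grade)
qed

lemma comp_zero: "comp 0 r = 0"
  using comp_homogeneous[OF zero_grade] by (simp add: fun_eq_iff)

lemma comp_scale: assumes "a \<in> G0" shows "comp (a * A) r = a * comp A r"
proof -
  let ?S = "{r. comp A r \<noteq> 0}"
  have "(\<Sum>r | a * comp A r \<noteq> 0. a * comp A r) = (\<Sum>r\<in>?S. a * comp A r)"
    using comp_finite[of A] by (intro sum.mono_neutral_left) auto
  also have "(\<Sum>r\<in>?S. a * comp A r) = a * A"
    unfolding sum_distrib_left[symmetric] by (rule arg_cong[OF comp_sum[symmetric]])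
  moreover have "finite {r. a * comp A r \<noteq> 0}"
    by (rule finite_subset[OF _ comp_finite[of A]]) auto
  ultimately have "is_decomp G0 G1 (a * A) (\<lambda>r. a * comp A r)"
    unfolding is_decomp_def using assms
    by (auto intro: scale_grade comp_grade)
  from comp_unique[OF this] show ?thesis by simp
qed

text \<open>Scalars are central because every multivector is a sum of blades, and blades commute
  with scalars.\<close>

lemma scalar_commute: assumes a: "a \<in> G0" shows "a * x = x * a"
proof -
  have "a * y = y * a" if "y \<in> gr r" for y r
  proof -
    have "y \<in> lin G0 (blades G0 G1 r)" using that grade_lin_blades by blast
    then show ?thesis
    proof induction
      case (lin_scale c x)
      have "a * (c * x) = c * (a * x)"
        using commute_scalar[OF a lin_scale(1)] by (simp add: mult.assoc[symmetric])
      also have "\<dots> = c * x * a" by (simp add: lin_scale mult.assoc)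
      finally show ?case .
    qed (auto simp: distrib_left distrib_right intro: scalar_blade_commute[OF a])
  qed
  then have "a * comp x r = comp x r * a" for r using comp_grade by blast
  then have "a * (\<Sum>r | comp x r \<noteq> 0. comp x r) = (\<Sum>r | comp x r \<noteq> 0. comp x r) * a"
    by (simp add: sum_distrib_left sum_distrib_right)
  then show ?thesis by (simp only: comp_sum[symmetric])
qed

text \<open>The product is bilinear over the scalars: a scalar in the second factor moves to the
  front by centrality.\<close>

lemma lin_mult:
  assumes "x \<in> lin G0 S" "y \<in> lin G0 T" "\<And>s t. s \<in> S \<Longrightarrow> t \<in> T \<Longrightarrow> s * t \<in> lin G0 U"
  shows "x * y \<in> lin G0 U"
  using assms(1)
proof induction
  case (lin_base s)
  from assms(2) show ?case
  proof induction
    case (lin_base t)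
    then show ?case using assms(3) \<open>s \<in> S\<close> by blast
  next
    case (lin_scale a t)
    have "s * (a * t) = a * (s * t)"
      using scalar_commute[OF lin_scale(1), of s] by (simp add: mult.assoc[symmetric])
    then show ?case using lin_scale by (simp add: lin.lin_scale)
  qed (auto simp: distrib_left intro: lin.intros)
qed (auto simp: distrib_right mult.assoc intro: lin.intros)

section \<open>Diagonalising the inner product on a finitely generated space\<close>

text \<open>Elements of \<open>E\<close> may be null or linearly dependent.\<close>

definition orthogonal_set :: "'a set \<Rightarrow> bool" where
  "orthogonal_set E \<longleftrightarrow> finite E \<and> E \<subseteq> G1 \<and> (\<forall>x\<in>E. \<forall>y\<in>E. x \<noteq> y \<longrightarrow> x * y + y * x = 0)"

text \<open>If two non-orthogonal vectors are both null, their sum is not, by polarisation. So a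
  pivot \<open>w\<close> is found among \<open>x\<close>, \<open>y\<close> and \<open>x + y\<close>,
  and it can replace one vector of \<open>V\<close> without loss of span.\<close>

lemma exists_pivot:
  assumes V: "finite V" "V \<subseteq> G1" "\<not> orthogonal_set V"
  obtains w x where "w \<in> lin G0 V" "w\<^sup>2 \<noteq> 0" "x \<in> V" "V \<subseteq> lin G0 (insert w (V - {x}))"
proof -
  obtain x y where xy: "x \<in> V" "y \<in> V" "x \<noteq> y" "x * y + y * x \<noteq> 0"
    using V unfolding orthogonal_set_def by auto
  consider "x\<^sup>2 \<noteq> 0" | "y\<^sup>2 \<noteq> 0" | "x\<^sup>2 = 0" "y\<^sup>2 = 0" by blast
  then show ?thesis
  proof cases
    case 1
    then show ?thesis using xy by (intro that[of x x]) (auto intro: lin_base)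
  next
    case 2
    then show ?thesis using xy by (intro that[of y y]) (auto intro: lin_base)
  next
    case 3
    then have "(x + y)\<^sup>2 = x * y + y * x"
      by (simp add: power2_eq_square algebra_simps)
    moreover have "(x + y) - y \<in> lin G0 (insert (x + y) (V - {x}))"
      using xy by (intro lin_diff lin_base) auto
    then have "V \<subseteq> lin G0 (insert (x + y) (V - {x}))"
      by (auto intro: lin_base)
    ultimately show ?thesis using xy by (intro that[of "x + y" x]) (auto intro: lin_add lin_base)
  qed
qed

lemma lin_anticommute:
  assumes "x \<in> lin G0 S" "\<And>s. s \<in> S \<Longrightarrow> s * w + w * s = 0"
  shows "x * w + w * x = 0"
  using assms(1)
proof induction
  case (lin_add x y)
  have "(x + y) * w + w * (x + y) = (x * w + w * x) + (y * w + w * y)"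
    by (simp add: algebra_simps)
  then show ?case using lin_add by simp
next
  case (lin_scale a x)
  have "a * x * w + w * (a * x) = a * (x * w + w * x)"
    using scalar_commute[OF lin_scale(1), of w] by (simp add: distrib_left mult.assoc[symmetric])
  then show ?case using lin_scale by simp
qed (auto intro: assms(2))

text \<open>Gram-Schmidt by induction on the size: split off a pivot \<open>w\<close>, make the
  remaining vectors orthogonal to it, and recurse. The inclusion
  \<open>E \<subseteq> lin G0 V\<close> belongs to the claim because it passes orthogonality to
  \<open>w\<close> on to the set obtained recursively.\<close>

lemma orthogonal_spanning_set:
  assumes "finite V" "V \<subseteq> G1"
  shows "\<exists>E. orthogonal_set E \<and> E \<subseteq> lin G0 V \<and> V \<subseteq> lin G0 E"
  using assms
proof (induction "card V" arbitrary: V rule: less_induct)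
  case less
  show ?case
  proof (cases "orthogonal_set V")
    case True
    then show ?thesis by (auto intro: lin_base)
  next
    case False
    then obtain w x where w: "w \<in> lin G0 V" "w\<^sup>2 \<noteq> 0" "x \<in> V"
      and V: "V \<subseteq> lin G0 (insert w (V - {x}))"
      using exists_pivot less.prems by blast
    have wG: "w \<in> G1" using w less.prems lin_vector by blast
    obtain q where q: "q \<in> G0" "w\<^sup>2 * q = 1"
      using inverse_scalar[OF square_scalar[OF wG] w(2)] by blast
    \<comment> \<open>The projection coefficient: the inner product of \<open>v\<close> and
      \<open>w\<close> divided by \<open>w\<^sup>2\<close>, whose inverse is
      \<open>q\<close>.\<close>
    define c where "c v = half G0 * (v * w + w * v) * q" for v
    define V' where "V' = (\<lambda>v. v - c v * w) ` (V - {x})"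
    have c: "c v \<in> G0" if "v \<in> V" for v
      unfolding c_def using that less.prems wG q half
      by (intro mult_scalar anticommutator_scalar) auto
    have V'V: "V' \<subseteq> lin G0 V"
      unfolding V'_def using c w by (auto intro: lin_diff lin_scale lin_base)
    have V'w: "s * w + w * s = 0" if "s \<in> V'" for s
    proof -
      from that obtain v where v: "v \<in> V" "s = v - c v * w" unfolding V'_def by blast
      let ?b = "v * w + w * v"
      have "s * w + w * s = ?b - c v * w * w - w * (c v * w)"
        by (simp add: v algebra_simps)
      also have "w * (c v * w) = c v * w * w"
        by (simp only: mult.assoc[symmetric] scalar_commute[OF c[OF v(1)], of w, symmetric])
      also have "c v * w * w = c v * w\<^sup>2" by (simp add: power2_eq_square mult.assoc)
      also have "c v * w\<^sup>2 = half G0 * ?b"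
        using q scalar_commute[OF q(1), of "w\<^sup>2"] by (simp add: c_def mult.assoc)
      also have "?b - half G0 * ?b - half G0 * ?b = ?b - 2 * half G0 * ?b"
        by (simp add: mult.assoc mult_2 distrib_right)
      finally show ?thesis by (simp add: half)
    qed
    \<comment> \<open>The vector \<open>x\<close> was dropped in favour of \<open>w\<close>, so the
      induction measure falls.\<close>
    have "card V' \<le> card (V - {x})"
      unfolding V'_def using less.prems by (intro card_image_le) auto
    also have "\<dots> < card V" using less.prems w by (intro card_Diff1_less) auto
    finally have "card V' < card V" .
    moreover have "finite V'" "V' \<subseteq> G1"
      using less.prems V'V lin_vector by (auto simp: V'_def)
    ultimately obtain E where E: "orthogonal_set E" "E \<subseteq> lin G0 V'" "V' \<subseteq> lin G0 E"
      using less.hyps by blast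
    have Ew: "e * w + w * e = 0" if "e \<in> E" for e
      using that E(2) V'w lin_anticommute by blast
    have "orthogonal_set (insert w E)"
      using E(1) Ew wG unfolding orthogonal_set_def by (auto simp: add.commute)
    moreover have "insert w E \<subseteq> lin G0 V"
      using w E(2) V'V lin_trans by blast
    moreover have "V \<subseteq> lin G0 (insert w E)"
    proof -
      have "v \<in> lin G0 (insert w E)" if "v \<in> V - {x}" for v
      proof -
        have "v - c v * w \<in> lin G0 E" using E(3) that V'_def by blast
        then have "v - c v * w \<in> lin G0 (insert w E)"
          using lin_mono[of E "insert w E"] by blast
        moreover have "c v * w \<in> lin G0 (insert w E)"
          using that c by (auto intro: lin_scale lin_base)
        ultimately have "(v - c v * w) + c v * w \<in> lin G0 (insert w E)" by (rule lin_add)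
        then show ?thesis by simp
      qed
      then have "insert w (V - {x}) \<subseteq> lin G0 (insert w E)" by (auto intro: lin_base)
      then show ?thesis using V lin_trans by blast
    qed
    ultimately show ?thesis by blast
  qed
qed

section \<open>Words in an orthogonal set and their products\<close>

text \<open>Letters are distinct but in no fixed order, since reordering only costs a sign when they
  anticommute. The empty word is \<open>1\<close>.\<close>

definition words :: "'a set \<Rightarrow> nat \<Rightarrow> 'a set" where
  "words E k = {prod_list xs | xs. distinct xs \<and> set xs \<subseteq> E \<and> length xs = k}"

lemma words_grade: assumes E: "orthogonal_set E" shows "words E k \<subseteq> gr k"
proof
  fix b assume "b \<in> words E k"
  then obtain xs where xs: "b = prod_list xs" "distinct xs" "set xs \<subseteq> E" "length xs = k"
    unfolding words_def by blast
  have "b \<in> blades G0 G1 k"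
  proof (cases "k = 0")
    case True
    then show ?thesis using xs one_scalar by (simp add: blades_def)
  next
    case False
    have "xs ! i * xs ! j + xs ! j * xs ! i = 0" if "i < k" "j < k" "i \<noteq> j" for i j
    proof -
      have "xs ! i \<in> E" "xs ! j \<in> E" "xs ! i \<noteq> xs ! j"
        using that xs by (auto simp: nth_eq_iff_index_eq)
      then show ?thesis using E unfolding orthogonal_set_def by blast
    qed
    then show ?thesis using False xs E unfolding blades_def vinner_eq_0_iff orthogonal_set_def
      by (simp only: if_False) blast
  qed
  then show "b \<in> gr k" by (rule blade_grade)
qed

text \<open>Each exchange of \<open>x\<close> with a factor changes the sign, so \<open>c\<close> is
  plus or minus one; only its being a scalar is recorded.\<close>

lemma anticommute_prod_list:
  assumes "\<And>y. y \<in> set ys \<Longrightarrow> x * y + y * x = 0"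
  shows "\<exists>c\<in>G0. x * prod_list ys = c * (prod_list ys * x)"
  using assms
proof (induction ys)
  case Nil
  then show ?case using one_scalar by force
next
  case (Cons y ys)
  then obtain c where c: "c \<in> G0" "x * prod_list ys = c * (prod_list ys * x)" by auto
  have "x * y = - (y * x)" using Cons.prems[of y] by (simp add: eq_neg_iff_add_eq_0)
  then have "x * prod_list (y # ys) = - (y * (x * prod_list ys))"
    by (simp add: mult.assoc[symmetric])
  also have "\<dots> = - (c * (y * (prod_list ys * x)))"
    using scalar_commute[OF c(1), of y] by (simp add: c mult.assoc[symmetric])
  also have "\<dots> = (- c) * (prod_list (y # ys) * x)" by (simp add: mult.assoc)
  finally show ?case using uminus_scalar[OF c(1)] by blast
qed

text \<open>A new letter is prepended. A letter already present is moved next to its occurrence,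
  where the two contract to the scalar \<open>x\<^sup>2\<close>, which is zero for a null
  vector.\<close>

lemma generator_mult_word:
  assumes E: "orthogonal_set E" and "x \<in> E" "distinct zs" "set zs \<subseteq> E"
  shows "\<exists>c\<in>G0. \<exists>zs'. x * prod_list zs = c * prod_list zs' \<and> distinct zs' \<and>
    set zs' = sym_diff {x} (set zs)"
proof (cases "x \<in> set zs")
  case False
  then show ?thesis using assms one_scalar
    by (intro bexI[of _ 1] exI[of _ "x # zs"]) auto
next
  case True
  then obtain as bs where zs: "zs = as @ x # bs" by (meson split_list)
  have "x * y + y * x = 0" if "y \<in> set as" for y
    using that zs assms unfolding orthogonal_set_def by (metis Un_iff distinct_append
        disjoint_iff list.set_intros(1) set_append subsetD)
  then obtain c where c: "c \<in> G0" "x * prod_list as = c * (prod_list as * x)"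
    using anticommute_prod_list by blast
  have x2: "x\<^sup>2 \<in> G0" using assms square_scalar unfolding orthogonal_set_def by blast
  have "x * prod_list zs = (x * prod_list as) * x * prod_list bs"
    by (simp add: zs mult.assoc)
  also have "\<dots> = c * (prod_list as * x\<^sup>2 * prod_list bs)"
    by (simp add: c power2_eq_square mult.assoc)
  also have "\<dots> = c * (x\<^sup>2 * prod_list as * prod_list bs)"
    by (subst scalar_commute[OF x2, of "prod_list as"]) (rule refl)
  also have "\<dots> = (c * x\<^sup>2) * prod_list (as @ bs)"
    by (simp add: mult.assoc)
  finally show ?thesis
    using c x2 assms zs by (intro bexI[of _ "c * x\<^sup>2"] exI[of _ "as @ bs"]) (auto intro: mult_scalar)
qed

lemma word_mult_word:
  assumes E: "orthogonal_set E" and "distinct xs" "set xs \<subseteq> E" "distinct ys" "set ys \<subseteq> E"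
  shows "\<exists>c\<in>G0. \<exists>zs. prod_list xs * prod_list ys = c * prod_list zs \<and> distinct zs \<and>
    set zs = sym_diff (set xs) (set ys)"
  using assms(2,3)
proof (induction xs)
  case Nil
  then show ?case using assms one_scalar by (intro bexI[of _ 1] exI[of _ ys]) auto
next
  case (Cons x xs)
  then obtain c zs where c: "c \<in> G0" and zs: "prod_list xs * prod_list ys = c * prod_list zs"
    "distinct zs" "set zs = sym_diff (set xs) (set ys)" by auto
  have "set zs \<subseteq> E" using zs(3) Cons.prems assms by auto
  then obtain d zs' where d: "d \<in> G0" and zs': "x * prod_list zs = d * prod_list zs'"
    "distinct zs'" "set zs' = sym_diff {x} (set zs)"
    using generator_mult_word[OF E] Cons.prems zs by (metis list.set_intros(1) subsetD)
  have "prod_list (x # xs) * prod_list ys = x * (c * prod_list zs)"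
    by (simp add: mult.assoc zs)
  also have "\<dots> = c * (x * prod_list zs)"
    using scalar_commute[OF c, of x] by (simp add: mult.assoc[symmetric])
  also have "\<dots> = (c * d) * prod_list zs'" by (simp add: zs' mult.assoc)
  finally have "prod_list (x # xs) * prod_list ys = (c * d) * prod_list zs'" .
  \<comment> \<open>As \<open>x\<close> does not occur in \<open>xs\<close>, inserting it into
    \<open>set xs\<close> is a symmetric difference with \<open>{x}\<close>, and symmetric
    differences associate.\<close>
  moreover have "set zs' = sym_diff (set (x # xs)) (set ys)"
    using zs' zs Cons.prems by auto
  ultimately show ?case using c d zs'(2) mult_scalar by blast
qed

text \<open>The lower end is computed in the integers because subtraction on \<open>nat\<close>
  truncates.\<close>

definition prod_range :: "nat \<Rightarrow> nat \<Rightarrow> nat set" where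
  "prod_range r s = {k. \<bar>int r - int s\<bar> \<le> int k \<and> k \<le> r + s}"

text \<open>Triangle inequalities: each of \<open>X\<close>, \<open>Y\<close> and
  \<open>sym_diff X Y\<close> lies in the union of the other two.\<close>

lemma card_sym_diff_prod_range:
  assumes "finite X" "finite Y"
  shows "card (sym_diff X Y) \<in> prod_range (card X) (card Y)"
proof -
  let ?D = "sym_diff X Y"
  have fin: "finite ?D" using assms by auto
  have "card X \<le> card (?D \<union> Y)" "card Y \<le> card (?D \<union> X)" "card ?D \<le> card (X \<union> Y)"
    using assms by (auto intro!: card_mono)
  moreover have "card (?D \<union> Y) \<le> card ?D + card Y" "card (?D \<union> X) \<le> card ?D + card X"
    "card (X \<union> Y) \<le> card X + card Y" by (rule card_Un_le)+
  ultimately show ?thesis unfolding prod_range_def by (simp only: mem_Collect_eq) linarith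
qed

lemma words_mult:
  assumes E: "orthogonal_set E" and "x \<in> words E r" "y \<in> words E s"
  shows "x * y \<in> lin G0 (\<Union>k\<in>prod_range r s. words E k)"
proof -
  obtain xs ys where x: "x = prod_list xs" "distinct xs" "set xs \<subseteq> E" "length xs = r"
    and y: "y = prod_list ys" "distinct ys" "set ys \<subseteq> E" "length ys = s"
    using assms unfolding words_def by blast
  obtain c zs where zs: "c \<in> G0" "x * y = c * prod_list zs" "distinct zs"
    "set zs = sym_diff (set xs) (set ys)"
    using word_mult_word[OF E x(2,3) y(2,3)] x y by blast
  have "length zs = card (sym_diff (set xs) (set ys))"
    using zs distinct_card by metis
  then have "length zs \<in> prod_range r s"
    using card_sym_diff_prod_range[of "set xs" "set ys"] x y by (simp add: distinct_card)
  moreover have "prod_list zs \<in> words E (length zs)"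
    using zs x y unfolding words_def by auto
  ultimately show ?thesis using zs by (auto intro: lin_scale lin_base)
qed

section \<open>The grades in a product of blades\<close>

text \<open>The factors are expanded over \<open>E\<close> and multiplied in one by one as words of
  length 1. Repeated letters contract, so several lengths can occur.\<close>

lemma prod_list_lin_words:
  assumes E: "orthogonal_set E"
  shows "set vs \<subseteq> lin G0 E \<Longrightarrow> prod_list vs \<in> lin G0 (\<Union>k. words E k)"
proof (induction vs)
  case Nil
  have "1 \<in> words E 0" unfolding words_def by simp
  then show ?case by (auto intro: lin_base)
next
  case (Cons v vs)
  have "x * y \<in> lin G0 (\<Union>k. words E k)" if "x \<in> E" "y \<in> (\<Union>k. words E k)" for x y
  proof -
    from that obtain k where "y \<in> words E k" by blast
    moreover have "x \<in> words E 1"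
      using that unfolding words_def by (auto intro!: exI[of _ "[x]"])
    ultimately have "x * y \<in> lin G0 (\<Union>k\<in>prod_range 1 k. words E k)"
      using words_mult[OF E] by blast
    moreover have "(\<Union>k\<in>prod_range 1 k. words E k) \<subseteq> (\<Union>k. words E k)" by blast
    ultimately show ?thesis using lin_mono by blast
  qed
  with Cons have "v * prod_list vs \<in> lin G0 (\<Union>k. words E k)"
    by (intro lin_mult[of v E "prod_list vs" "\<Union>k. words E k"]) simp_all
  then show ?case by simp
qed

text \<open>Words are homogeneous, so taking the component of grade \<open>r\<close> keeps those of
  length \<open>r\<close> and kills the others.\<close>

lemma comp_lin_words:
  assumes E: "orthogonal_set E" and "x \<in> lin G0 (\<Union>k. words E k)"
  shows "comp x r \<in> lin G0 (words E r)"
  using assms(2)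
proof induction
  case (lin_base x)
  then obtain k where "x \<in> words E k" by blast
  moreover from this have "x \<in> gr k" using words_grade[OF E] by blast
  ultimately show ?case by (cases "r = k") (simp_all add: comp_homogeneous lin.lin_zero lin.lin_base)
qed (simp_all add: comp_zero comp_add comp_scale lin.lin_zero lin.lin_add lin.lin_scale)

text \<open>Expanding a blade in words over \<open>E\<close> gives words of all lengths; by uniqueness of the
  decomposition into grades only those of length \<open>r\<close> contribute.\<close>

lemma blade_lin_words:
  assumes b: "b \<in> blades G0 G1 r"
  obtains V where "finite V" "V \<subseteq> G1"
    "\<And>E. orthogonal_set E \<Longrightarrow> V \<subseteq> lin G0 E \<Longrightarrow> b \<in> lin G0 (words E r)"
proof (cases "r = 0")
  case True
  then have "b \<in> G0" using b by (simp add: blades_def)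
  moreover have "1 \<in> words E r" for E
    using True unfolding words_def by simp
  ultimately have "b * 1 \<in> lin G0 (words E r)" for E
    by (rule lin_scale[OF _ lin_base])
  then show ?thesis by (intro that[of "{}"]) simp_all
next
  case False
  then obtain vs where vs: "b = prod_list vs" "set vs \<subseteq> G1"
    using b unfolding blades_def by auto
  have "b \<in> lin G0 (words E r)" if E: "orthogonal_set E" "set vs \<subseteq> lin G0 E" for E
  proof -
    have "comp b r \<in> lin G0 (words E r)"
      using comp_lin_words prod_list_lin_words vs E by blast
    then show ?thesis by (simp add: comp_homogeneous[OF blade_grade[OF b]])
  qed
  then show ?thesis using vs by (intro that[of "set vs"]) auto
qed

lemma blade_mult:
  assumes "a \<in> blades G0 G1 r" "b \<in> blades G0 G1 s"
  shows "a * b \<in> lin G0 (\<Union>k\<in>prod_range r s. gr k)"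
proof -
  obtain V where V: "finite V" "V \<subseteq> G1"
    "\<And>E. orthogonal_set E \<Longrightarrow> V \<subseteq> lin G0 E \<Longrightarrow> a \<in> lin G0 (words E r)"
    using blade_lin_words[OF assms(1)] by metis
  obtain W where W: "finite W" "W \<subseteq> G1"
    "\<And>E. orthogonal_set E \<Longrightarrow> W \<subseteq> lin G0 E \<Longrightarrow> b \<in> lin G0 (words E s)"
    using blade_lin_words[OF assms(2)] by metis
  \<comment> \<open>Both blades must be expanded over the same \<open>E\<close>; for this reason
    \<open>blade_lin_words\<close> holds for every \<open>E\<close> whose span contains the given
    vectors.\<close>
  obtain E where E: "orthogonal_set E" "V \<union> W \<subseteq> lin G0 E"
    using orthogonal_spanning_set[of "V \<union> W"] V W by auto
  have "a * b \<in> lin G0 (\<Union>k\<in>prod_range r s. words E k)"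
    using V W E by (intro lin_mult[OF _ _ words_mult[OF E(1)]]) auto
  moreover have "(\<Union>k\<in>prod_range r s. words E k) \<subseteq> (\<Union>k\<in>prod_range r s. gr k)"
    using words_grade[OF E(1)] by blast
  ultimately show ?thesis using lin_mono by blast
qed

lemma grade_mult:
  assumes "a \<in> gr r" "b \<in> gr s"
  shows "a * b \<in> lin G0 (\<Union>k\<in>prod_range r s. gr k)"
  using assms grade_lin_blades by (intro lin_mult[OF _ _ blade_mult]) auto

lemma comp_lin_grades_eq_0:
  assumes "x \<in> lin G0 (\<Union>k\<in>K. gr k)" "k \<notin> K"
  shows "comp x k = 0"
  using assms(1)
proof induction
  case (lin_base x)
  then show ?case using assms(2) by (auto simp: comp_homogeneous)
qed (auto simp: comp_zero comp_add comp_scale)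

lemma comp_mult_eq_0:
  "a \<in> gr r \<Longrightarrow> b \<in> gr s \<Longrightarrow> k \<notin> prod_range r s \<Longrightarrow> comp (a * b) k = 0"
  using grade_mult comp_lin_grades_eq_0 by blast

section \<open>Parts of products\<close>

lemma part_int: "part x (int k) = comp x k"
  by (simp add: gpart_def)

lemma part_add: "part (A + B) k = part A k + part B k"
  by (simp add: gpart_def comp_add)

lemma part_zero: "part 0 k = 0"
  by (simp add: gpart_def comp_zero)

lemma part_sum: "part (\<Sum>i\<in>I. f i) k = (\<Sum>i\<in>I. part (f i) k)"
  by (induction I rule: infinite_finite_induct) (auto simp: part_zero part_add)

lemma part_mult_eq_0:
  assumes "a \<in> gr r" "b \<in> gr s" "\<not> (\<bar>int r - int s\<bar> \<le> n \<and> n \<le> int r + int s)"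
  shows "part (a * b) n = 0"
proof (cases "n < 0")
  case False
  then have "nat n \<notin> prod_range r s" using assms(3) unfolding prod_range_def by auto
  then show ?thesis using comp_mult_eq_0[OF assms(1,2)] by (simp add: gpart_def)
qed (simp add: gpart_def)

text \<open>Condition \<open>z\<close> says that no component of \<open>x\<close> other than that of
  grade \<open>m\<close> can reach grade \<open>n\<close>, so the inner projection may be dropped.
  The grade \<open>m\<close> may be negative.\<close>

lemma part_left_mult_part:
  assumes a: "a \<in> gr r"
    and z: "\<And>k. int k \<noteq> m \<Longrightarrow> comp x k \<noteq> 0 \<Longrightarrow> \<not> (\<bar>int r - int k\<bar> \<le> n \<and> n \<le> int r + int k)"
  shows "part (a * part x m) n = part (a * x) n"
proof -
  have *: "part (a * comp x k) n = 0" if "int k \<noteq> m" for k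
  proof (cases "comp x k = 0")
    case False
    then show ?thesis using part_mult_eq_0[OF a comp_grade] z[OF that] by blast
  qed (simp add: part_zero)
  have "part (a * x) n = (\<Sum>k | comp x k \<noteq> 0. part (a * comp x k) n)"
    unfolding part_sum[symmetric] sum_distrib_left[symmetric]
    by (simp only: comp_sum[symmetric])
  also have "\<dots> = (\<Sum>k | comp x k \<noteq> 0. if int k = m then part (a * part x m) n else 0)"
    by (intro sum.cong) (auto simp: * part_int)
  also have "\<dots> = (\<Sum>k | comp x k \<noteq> 0 \<and> int k = m. part (a * part x m) n)"
    using comp_finite[of x] by (subst sum.inter_filter[symmetric]) auto
  also have "\<dots> = part (a * part x m) n"
  proof (cases "part x m = 0")
    case True
    then show ?thesis by (simp add: part_zero)
  next
    case False
    \<comment> \<open>A nonzero part forces \<open>0 \<le> m\<close> with \<open>nat m\<close> in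
      the support, so exactly one term remains.\<close>
    then have "{k. comp x k \<noteq> 0 \<and> int k = m} = {nat m}"
      by (auto simp: gpart_def split: if_splits)
    then show ?thesis by simp
  qed
  finally show ?thesis by simp
qed

text \<open>The mirror image of \<open>part_left_mult_part\<close>.\<close>

lemma part_right_mult_part:
  assumes a: "a \<in> gr r"
    and z: "\<And>k. int k \<noteq> m \<Longrightarrow> comp x k \<noteq> 0 \<Longrightarrow> \<not> (\<bar>int k - int r\<bar> \<le> n \<and> n \<le> int k + int r)"
  shows "part (part x m * a) n = part (x * a) n"
proof -
  have *: "part (comp x k * a) n = 0" if "int k \<noteq> m" for k
  proof (cases "comp x k = 0")
    case False
    then show ?thesis using part_mult_eq_0[OF comp_grade a] z[OF that] by blast
  qed (simp add: part_zero)
  have "part (x * a) n = (\<Sum>k | comp x k \<noteq> 0. part (comp x k * a) n)"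
    unfolding part_sum[symmetric] sum_distrib_right[symmetric]
    by (simp only: comp_sum[symmetric])
  also have "\<dots> = (\<Sum>k | comp x k \<noteq> 0. if int k = m then part (part x m * a) n else 0)"
    by (intro sum.cong) (auto simp: * part_int)
  also have "\<dots> = (\<Sum>k | comp x k \<noteq> 0 \<and> int k = m. part (part x m * a) n)"
    using comp_finite[of x] by (subst sum.inter_filter[symmetric]) auto
  also have "\<dots> = part (part x m * a) n"
  proof (cases "part x m = 0")
    case True
    then show ?thesis by (simp add: part_zero)
  next
    case False
    then have "{k. comp x k \<noteq> 0 \<and> int k = m} = {nat m}"
      by (auto simp: gpart_def split: if_splits)
    then show ?thesis by simp
  qed
  finally show ?thesis by simp
qed

section \<open>Biadditivity of the graded products\<close>

abbreviation gprod :: "(int \<Rightarrow> int \<Rightarrow> int) \<Rightarrow> 'a \<Rightarrow> 'a \<Rightarrow> 'a" where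
  "gprod d \<equiv> graded_prod d G0 G1"

text \<open>Terms outside the supports vanish, so products with different arguments can be compared
  over common index sets.\<close>

lemma gprod_eq_sum:
  assumes "finite R" "finite S" "{r. comp A r \<noteq> 0} \<subseteq> R" "{s. comp B s \<noteq> 0} \<subseteq> S"
  shows "gprod d A B = (\<Sum>r\<in>R. \<Sum>s\<in>S. part (comp A r * comp B s) (d (int r) (int s)))"
proof -
  have "gprod d A B = (\<Sum>r | comp A r \<noteq> 0. \<Sum>s\<in>S. part (comp A r * comp B s) (d (int r) (int s)))"
    unfolding graded_prod_def using assms
    by (intro sum.cong refl sum.mono_neutral_left) (auto simp: part_zero)
  also have "\<dots> = (\<Sum>r\<in>R. \<Sum>s\<in>S. part (comp A r * comp B s) (d (int r) (int s)))"
    using assms by (intro sum.mono_neutral_left) (auto simp: part_zero)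
  finally show ?thesis .
qed

lemma gprod_add_left: "gprod d (A + A') B = gprod d A B + gprod d A' B"
proof -
  let ?R = "{r. comp A r \<noteq> 0} \<union> {r. comp A' r \<noteq> 0}" and ?S = "{s. comp B s \<noteq> 0}"
  have eq: "gprod d X B = (\<Sum>r\<in>?R. \<Sum>s\<in>?S. part (comp X r * comp B s) (d (int r) (int s)))"
    if "{r. comp X r \<noteq> 0} \<subseteq> ?R" for X
    using that by (intro gprod_eq_sum) (auto simp: comp_finite)
  have "{r. comp (A + A') r \<noteq> 0} \<subseteq> ?R" by (auto simp: comp_add)
  from eq[OF this] show ?thesis
    by (simp add: eq comp_add distrib_right part_add sum.distrib)
qed

lemma gprod_add_right: "gprod d A (B + B') = gprod d A B + gprod d A B'"
proof -
  let ?S = "{r. comp B r \<noteq> 0} \<union> {r. comp B' r \<noteq> 0}" and ?R = "{s. comp A s \<noteq> 0}"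
  have eq: "gprod d A X = (\<Sum>r\<in>?R. \<Sum>s\<in>?S. part (comp A r * comp X s) (d (int r) (int s)))"
    if "{r. comp X r \<noteq> 0} \<subseteq> ?S" for X
    using that by (intro gprod_eq_sum) (auto simp: comp_finite)
  have "{r. comp (B + B') r \<noteq> 0} \<subseteq> ?S" by (auto simp: comp_add)
  from eq[OF this] show ?thesis
    by (simp add: eq comp_add distrib_left part_add sum.distrib)
qed

lemma gprod_homogeneous:
  assumes "a \<in> gr r" "b \<in> gr s"
  shows "gprod d a b = part (a * b) (d (int r) (int s))"
proof -
  have "gprod d a b = (\<Sum>r\<in>{r}. \<Sum>s\<in>{s}. part (comp a r * comp b s) (d (int r) (int s)))"
    using assms by (intro gprod_eq_sum) (auto simp: comp_homogeneous)
  then show ?thesis using assms by (simp add: comp_homogeneous)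
qed

lemma gprod_zero: "gprod d 0 B = 0" "gprod d A 0 = 0"
  by (auto simp: graded_prod_def comp_zero)

text \<open>For negative \<open>m\<close> the part is \<open>0\<close> and both sides vanish, so any
  grade selected by an inner product is covered.\<close>

lemma gprod_part_right:
  assumes "a \<in> gr r" shows "gprod d a (part x m) = part (a * part x m) (d (int r) m)"
proof (cases "m < 0")
  case False
  then have "part x m \<in> gr (nat m)" by (simp add: gpart_def comp_grade)
  from gprod_homogeneous[OF assms this] show ?thesis using False by simp
qed (simp add: gpart_def gprod_zero comp_zero)

lemma gprod_part_left:
  assumes "a \<in> gr r" shows "gprod d (part x m) a = part (part x m * a) (d m (int r))"
proof (cases "m < 0")
  case False
  then have "part x m \<in> gr (nat m)" by (simp add: gpart_def comp_grade)
  from gprod_homogeneous[OF this assms] show ?thesis using False by simp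
qed (simp add: gpart_def gprod_zero comp_zero)

text \<open>A multivector is the finite sum of its components, so additive identities need checking
  only on homogeneous elements.\<close>

lemma homogeneous_induct [case_names zero add homogeneous]:
  assumes "P 0" "\<And>x y. P x \<Longrightarrow> P y \<Longrightarrow> P (x + y)" "\<And>x r. x \<in> gr r \<Longrightarrow> P x"
  shows "P A"
proof -
  have "P (\<Sum>r\<in>I. comp A r)" for I
    by (induction I rule: infinite_finite_induct) (auto intro: assms comp_grade)
  from this[of "{r. comp A r \<noteq> 0}"] show ?thesis by (simp only: comp_sum[symmetric])
qed

section \<open>Associativity from the arithmetic of grades\<close>

text \<open>The two arithmetic conditions say that, in the triple product of grades \<open>r\<close>, \<open>s\<close>, \<open>t\<close>,
  only the selected grade of the inner product can reach the selected grade of the whole.\<close>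

lemma gprod_assoc:
  assumes grades: "\<And>r s t. 0 \<le> r \<Longrightarrow> 0 \<le> s \<Longrightarrow> 0 \<le> t \<Longrightarrow> d1 r (d2 s t) = d3 (d4 r s) t"
    and right: "\<And>r s t k. 0 \<le> r \<Longrightarrow> 0 \<le> s \<Longrightarrow> 0 \<le> t \<Longrightarrow> \<bar>s - t\<bar> \<le> k \<Longrightarrow> k \<le> s + t \<Longrightarrow> k \<noteq> d2 s t \<Longrightarrow>
      \<not> (\<bar>r - k\<bar> \<le> d1 r (d2 s t) \<and> d1 r (d2 s t) \<le> r + k)"
    and left: "\<And>r s t k. 0 \<le> r \<Longrightarrow> 0 \<le> s \<Longrightarrow> 0 \<le> t \<Longrightarrow> \<bar>r - s\<bar> \<le> k \<Longrightarrow> k \<le> r + s \<Longrightarrow> k \<noteq> d4 r s \<Longrightarrow>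
      \<not> (\<bar>k - t\<bar> \<le> d3 (d4 r s) t \<and> d3 (d4 r s) t \<le> k + t)"
  shows "gprod d1 A (gprod d2 B C) = gprod d3 (gprod d4 A B) C"
proof -
  have hom: "gprod d1 a (gprod d2 b c) = gprod d3 (gprod d4 a b) c"
    if abc: "a \<in> gr r" "b \<in> gr s" "c \<in> gr t" for a b c r s t
  proof -
    let ?r = "int r" and ?s = "int s" and ?t = "int t"
    have "gprod d1 a (gprod d2 b c) = part (a * part (b * c) (d2 ?s ?t)) (d1 ?r (d2 ?s ?t))"
      using abc by (simp add: gprod_homogeneous gprod_part_right)
    also have "\<dots> = part (a * (b * c)) (d1 ?r (d2 ?s ?t))"
    proof (rule part_left_mult_part[OF abc(1)])
      fix k assume k: "int k \<noteq> d2 ?s ?t" "comp (b * c) k \<noteq> 0"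
      then have "k \<in> prod_range s t" using comp_mult_eq_0 abc by blast
      then have "\<bar>?s - ?t\<bar> \<le> int k" "int k \<le> ?s + ?t" unfolding prod_range_def by auto
      from right[OF _ _ _ this k(1)]
      show "\<not> (\<bar>?r - int k\<bar> \<le> d1 ?r (d2 ?s ?t) \<and> d1 ?r (d2 ?s ?t) \<le> ?r + int k)" by simp
    qed
    also have "\<dots> = part (a * b * c) (d3 (d4 ?r ?s) ?t)"
      by (simp add: grades mult.assoc)
    also have "\<dots> = part (part (a * b) (d4 ?r ?s) * c) (d3 (d4 ?r ?s) ?t)"
    proof (rule part_right_mult_part[OF abc(3), symmetric])
      fix k assume k: "int k \<noteq> d4 ?r ?s" "comp (a * b) k \<noteq> 0"
      then have "k \<in> prod_range r s" using comp_mult_eq_0 abc by blast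
      then have "\<bar>?r - ?s\<bar> \<le> int k" "int k \<le> ?r + ?s" unfolding prod_range_def by auto
      from left[OF _ _ _ this k(1)]
      show "\<not> (\<bar>int k - ?t\<bar> \<le> d3 (d4 ?r ?s) ?t \<and> d3 (d4 ?r ?s) ?t \<le> int k + ?t)" by simp
    qed
    also have "\<dots> = gprod d3 (gprod d4 a b) c"
      using abc by (simp add: gprod_homogeneous gprod_part_left)
    finally show ?thesis .
  qed
  \<comment> \<open>Both sides are additive in each argument, so the homogeneous case extends first
    to \<open>C\<close>, then to \<open>B\<close>, then to \<open>A\<close>.\<close>
  have "gprod d1 a (gprod d2 b C) = gprod d3 (gprod d4 a b) C" if "a \<in> gr r" "b \<in> gr s" for a b r s
    using that by (induction C rule: homogeneous_induct)
      (auto simp: gprod_zero gprod_add_left gprod_add_right intro: hom)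
  then have "gprod d1 a (gprod d2 B C) = gprod d3 (gprod d4 a B) C" if "a \<in> gr r" for a r
    using that by (induction B rule: homogeneous_induct)
      (auto simp: gprod_zero gprod_add_left gprod_add_right)
  then show ?thesis
    by (induction A rule: homogeneous_induct)
      (auto simp: gprod_zero gprod_add_left gprod_add_right)
qed

end

theorem theorem13:
  fixes G0 G1 :: "'a::ring_char_0 set" and A B C :: 'a
  assumes "geometric_algebra G0 G1"
  shows "outer G0 G1 A (outer G0 G1 B C) = outer G0 G1 (outer G0 G1 A B) C \<and>
    left_inner G0 G1 A (right_inner G0 G1 B C) = right_inner G0 G1 (left_inner G0 G1 A B) C \<and>
    left_inner G0 G1 A (left_inner G0 G1 B C) = left_inner G0 G1 (outer G0 G1 A B) C \<and>
    right_inner G0 G1 A (outer G0 G1 B C) = right_inner G0 G1 (right_inner G0 G1 A B) C"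
proof -
  interpret geometric_algebra G0 G1 by fact
  show ?thesis
    unfolding outer_def left_inner_def right_inner_def
    \<comment> \<open>The outer product selects the top of the range of grades and the inner
      products select at most its bottom. Any other intermediate grade \<open>k\<close> therefore
      misses the target by a strict inequality: for instance \<open>k < s + t\<close> gives
      \<open>r + k < r + s + t\<close>, and \<open>k > t - s\<close> gives
      \<open>k - r > t - s - r\<close>.\<close>
    by (intro conjI gprod_assoc) linarith+
qed

end
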